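(* Let $$A = \{t \in \mathbb{Z} : t = 3x^2 - y^2 \text{ for some } x, y \in \mathbb{Z}\},$$ $$B = \{t \in \mathbb{Z} : t = x^2 + y^2 \text{ for some } x, y \in \mathbb{Z}\},$$ $$C = \{t \in \mathbb{Z} : t = 2(x^2 - xy + y^2) \text{ for some } x, y \in \mathbb{Z}\}.$$ Then the following proper inclusions hold: $$A \cap B \subsetneq C, \qquad B \cap C \subsetneq A, \qquad C \cap A \subsetneq B.$$
   Context: The symbol $\subsetneq$ denotes strict (proper) inclusion. *)

theory Defs
  imports Main
begin

definition A :: "int set"
  where "A = {t. \<exists>x y :: int. t = 3 * x\<^sup>2 - y\<^sup>2}"

definition B :: "int set"
  where "B = {t. \<exists>x y :: int. t = x\<^sup>2 + y\<^sup>2}"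

definition C :: "int set"
  where "C = {t. \<exists>x y :: int. t = 2 * (x\<^sup>2 - x * y + y\<^sup>2)}"

end

theory Submission
  imports Defs
begin

text \<open>
  Since \<open>2 = 1\<^sup>2 + 1\<^sup>2\<close> and \<open>-2\<close> is the norm of \<open>1 + \<surd>3\<close>, the doubled elements of the three
  sets are norms from \<open>\<rat>(\<surd>3)\<close>, \<open>\<rat>(i)\<close> and \<open>\<rat>(\<surd>-3)\<close>, respectively: the quadratic subfields of
  a biquadratic field. If \<open>T = N(\<alpha>) = N(\<beta>)\<close> for two of these fields, then
  \<open>(\<alpha> + \<beta>)(\<alpha>' + \<beta>')\<close> lies in the third one and has norm \<open>T\<close> times a square, so \<open>T\<close> is a norm
  there up to a rational square. The three binary forms are norm-Euclidean, so the descent of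
  Aubry, Davenport and Cassels turns the rational representations into integral ones.
\<close>

section \<open>Descent from rational to integral representations\<close>

definition bqf :: "int \<Rightarrow> int \<Rightarrow> int \<Rightarrow> int \<Rightarrow> int \<Rightarrow> int"
  where "bqf a b c x y = a * x\<^sup>2 + b * x * y + c * y\<^sup>2"

lemma nearest_multiple:
  fixes x d :: int
  assumes "d > 0"
  obtains m where "\<bar>2 * (x - d * m)\<bar> \<le> d"
proof
  \<comment> \<open>The floor of \<open>x / d + 1/2\<close>, that is, \<open>x / d\<close> rounded
    to a nearest integer.\<close>
  let ?m = "(2 * x + d) div (2 * d)"
  have "2 * x + d = 2 * d * ?m + (2 * x + d) mod (2 * d)"
    by simp
  moreover have "0 \<le> (2 * x + d) mod (2 * d)" "(2 * x + d) mod (2 * d) < 2 * d"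
    using assms by simp_all
  ultimately show "\<bar>2 * (x - d * ?m)\<bar> \<le> d"
    by (simp add: abs_le_iff algebra_simps)
qed

text \<open>
  The integer point \<open>(k, l)\<close> is nearest to \<open>(X/d, Y/d)\<close>; the line through both meets the
  conic \<open>bqf a b c = n\<close> again in a point with the smaller denominator \<open>d'\<close>.
\<close>

theorem aubry_davenport_cassels:
  fixes a b c n d X Y :: int
  assumes anisotropic: "\<And>x y. bqf a b c x y = 0 \<Longrightarrow> x = 0 \<and> y = 0"
    and euclidean: "\<And>d u v. d > 0 \<Longrightarrow> \<bar>2 * u\<bar> \<le> d \<Longrightarrow> \<bar>2 * v\<bar> \<le> d \<Longrightarrow> \<bar>bqf a b c u v\<bar> < d\<^sup>2"
    and "d \<noteq> 0" and "n * d\<^sup>2 = bqf a b c X Y"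
  shows "\<exists>x y. n = bqf a b c x y"
  using assms(3,4)
proof (induction "nat \<bar>d\<bar>" arbitrary: d X Y rule: less_induct)
  case less
  have pos: "\<bar>d\<bar> > 0"
    using less.prems by simp
  obtain k where k': "\<bar>2 * (X - \<bar>d\<bar> * k)\<bar> \<le> \<bar>d\<bar>"
    using nearest_multiple[OF pos] .
  obtain l where l': "\<bar>2 * (Y - \<bar>d\<bar> * l)\<bar> \<le> \<bar>d\<bar>"
    using nearest_multiple[OF pos] .
  define e where "e = \<bar>d\<bar>"
  have e: "e > 0" "n * e\<^sup>2 = bqf a b c X Y"
    using less.prems by (simp_all add: e_def)
  define u v where "u = X - e * k" and "v = Y - e * l"
  \<comment> \<open>This is \<open>bqf a b c u v / e\<close> in integral form: expanding the form at
    \<open>(X - e * k, Y - e * l)\<close>, the one term without a visible factor \<open>e\<close> is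
    \<open>bqf a b c X Y\<close>, which equals \<open>n * e^2\<close>.\<close>
  define d' where "d' = n * e - (2 * a * X * k + b * (X * l + Y * k) + 2 * c * Y * l)
    + e * bqf a b c k l"
  define h where "h = bqf a b c k l - n"
  have uv: "bqf a b c u v = e * d'"
    using e(2) unfolding u_def v_def d'_def bqf_def by algebra
  show ?case
  proof (cases "d' = 0")
    case True
    then have "X = e * k" "Y = e * l"
      using anisotropic[of u v] uv by (simp_all add: u_def v_def)
    then have "e\<^sup>2 * n = e\<^sup>2 * bqf a b c k l"
      using e(2) unfolding bqf_def by algebra
    then show ?thesis
      using e(1) by auto
  next
    case False
    have "\<bar>e * d'\<bar> < e\<^sup>2"
      using euclidean[OF e(1), of u v] k' l' uv by (simp add: u_def v_def e_def)
    then have "e * \<bar>d'\<bar> < e * e"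
      using e(1) by (simp add: abs_mult power2_eq_square)
    then have "\<bar>d'\<bar> < e"
      using e(1) by (simp only: mult_less_cancel_left_pos)
    then have "\<bar>d'\<bar> < \<bar>d\<bar>"
      by (simp only: e_def)
    moreover have "n * d'\<^sup>2 = bqf a b c (d' * k + h * u) (d' * l + h * v)"
    proof -
      \<comment> \<open>On the line \<open>(k, l) + s * (u, v)\<close> the conic is a quadratic
        equation in \<open>s\<close> whose roots have product \<open>h / (e * d')\<close>. The
        identity says that \<open>1 / e\<close> is a root, so the other root is
        \<open>h / d'\<close>.\<close>
      have "d' + (2 * a * k * u + b * (k * v + l * u) + 2 * c * l * v) + h * e = 0"
        unfolding d'_def u_def v_def h_def bqf_def by algebra
      then show ?thesis
        using uv unfolding h_def bqf_def by algebra
    qed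
    ultimately show ?thesis
      using less.hyps[of d'] False by (simp add: nat_less_iff)
  qed
qed

section \<open>Common norms from two quadratic fields\<close>

text \<open>For \<alpha> = \<open>p + q\<close>\<surd>\<open>D\<close> and \<beta> =
  \<open>r + s\<close>\<surd>\<open>E\<close>, half of (\<alpha> + \<beta>)(\<alpha>' + \<beta>') is
  \<open>T + p * r - q * s\<close>\<surd>\<open>(D * E)\<close>, of norm
  \<open>T * (p + r)^2\<close>. The sign of \<open>r\<close> is free, and \<open>p + r\<close> and
  \<open>p - r\<close> both vanish only for \<open>p = r = 0\<close>.\<close>

lemma common_norm:
  fixes T D E p q r s :: int
  assumes "T \<noteq> 0" and "T = p\<^sup>2 - D * q\<^sup>2" and "T = r\<^sup>2 - E * s\<^sup>2"
  shows "\<exists>d X Y. d \<noteq> 0 \<and> T * d\<^sup>2 = X\<^sup>2 - D * E * Y\<^sup>2"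
proof -
  have id: "T * (p + r')\<^sup>2 = (T + p * r')\<^sup>2 - D * E * (q * s)\<^sup>2" if "T = r'\<^sup>2 - E * s\<^sup>2" for r'
    using that assms(2) by algebra
  consider "p + r \<noteq> 0" | "p + - r \<noteq> 0" | "p = 0" "r = 0"
    by linarith
  then show ?thesis
  proof cases
    case 1
    then show ?thesis using id assms(3) by blast
  next
    case 2
    have "T = (- r)\<^sup>2 - E * s\<^sup>2"
      using assms(3) by simp
    then show ?thesis using 2 id by blast
  next
    case 3
    \<comment> \<open>Here \<open>T\<^sup>2 = D * E * (q * s)\<^sup>2\<close>, so the target form is isotropic; write
      \<open>4 * T = (T + 1)\<^sup>2 - (T - 1)\<^sup>2\<close>.\<close>
    have "T * (2 * T)\<^sup>2 = (T * (T + 1))\<^sup>2 - D * E * (q * s * (T - 1))\<^sup>2"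
      using assms(2,3) 3 by algebra
    moreover have "2 * T \<noteq> 0"
      using assms(1) by simp
    ultimately show ?thesis by blast
  qed
qed

section \<open>Rational criteria for membership\<close>

text \<open>Irrationality of \<surd>3, which makes the form of \<open>A\<close> anisotropic: a
  solution with \<open>x \<noteq> 0\<close> would make 3 the square of an integer.\<close>

lemma three_squares_eq_square:
  fixes x y :: int
  assumes "3 * x\<^sup>2 = y\<^sup>2"
  shows "x = 0 \<and> y = 0"
proof (cases "x = 0")
  case True
  then show ?thesis using assms by simp
next
  case False
  have "x\<^sup>2 dvd y\<^sup>2"
    using assms by (metis dvd_triv_right)
  then have "x dvd y"
    by simp
  then obtain k where "y = x * k" ..
  then have "x\<^sup>2 * 3 = x\<^sup>2 * k\<^sup>2"
    using assms by (simp add: power_mult_distrib)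
  then have k: "\<bar>k\<bar>\<^sup>2 = 3"
    using False by simp
  have "\<bar>k\<bar> < 2"
    by (rule power2_less_imp_less) (use k in simp_all)
  moreover have "1 < \<bar>k\<bar>"
    by (rule power2_less_imp_less) (use k in simp_all)
  ultimately show ?thesis by linarith
qed

lemma half_square_bound:
  fixes u d :: int
  assumes "\<bar>2 * u\<bar> \<le> d"
  shows "4 * u\<^sup>2 \<le> d\<^sup>2"
  using power_mono[OF assms, of 2] by (simp add: power_mult_distrib)

lemma A_rational:
  fixes t d x y :: int
  assumes "d \<noteq> 0" and "t * d\<^sup>2 = 3 * x\<^sup>2 - y\<^sup>2"
  shows "t \<in> A"
proof -
  have "\<exists>x y. t = bqf 3 0 (-1) x y"
  proof (rule aubry_davenport_cassels)
    show "x = 0 \<and> y = 0" if "bqf 3 0 (-1) x y = 0" for x y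
      using that three_squares_eq_square[of x y] by (simp add: bqf_def)
    show "\<bar>bqf 3 0 (-1) u v\<bar> < d\<^sup>2" if "d > 0" "\<bar>2 * u\<bar> \<le> d" "\<bar>2 * v\<bar> \<le> d" for d u v
    proof -
      have "0 < d\<^sup>2" "0 \<le> u\<^sup>2" "0 \<le> v\<^sup>2"
        using that(1) by simp_all
      \<comment> \<open>The value lies between \<open>- d^2 / 4\<close> and
        \<open>3 * d^2 / 4\<close>.\<close>
      then show ?thesis
        using half_square_bound[OF that(2)] half_square_bound[OF that(3)]
        unfolding bqf_def abs_less_iff by linarith
    qed
    show "t * d\<^sup>2 = bqf 3 0 (-1) x y"
      using assms(2) by (simp add: bqf_def)
  qed fact
  then show ?thesis by (simp add: A_def bqf_def)
qed

lemma B_rational: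
  fixes t d x y :: int
  assumes "d \<noteq> 0" and "t * d\<^sup>2 = x\<^sup>2 + y\<^sup>2"
  shows "t \<in> B"
proof -
  have "\<exists>x y. t = bqf 1 0 1 x y"
  proof (rule aubry_davenport_cassels)
    show "x = 0 \<and> y = 0" if "bqf 1 0 1 x y = 0" for x y
      using that by (simp add: bqf_def sum_power2_eq_zero_iff)
    show "\<bar>bqf 1 0 1 u v\<bar> < d\<^sup>2" if "d > 0" "\<bar>2 * u\<bar> \<le> d" "\<bar>2 * v\<bar> \<le> d" for d u v
    proof -
      have "0 < d\<^sup>2" "0 \<le> u\<^sup>2" "0 \<le> v\<^sup>2"
        using that(1) by simp_all
      then show ?thesis
        using half_square_bound[OF that(2)] half_square_bound[OF that(3)]
        unfolding bqf_def abs_less_iff by linarith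
    qed
    show "t * d\<^sup>2 = bqf 1 0 1 x y"
      using assms(2) by (simp add: bqf_def)
  qed fact
  then show ?thesis by (simp add: B_def bqf_def)
qed

text \<open>The form \<open>x^2 + 3 * y^2\<close> itself is not Euclidean, since it takes the value
  \<open>d^2\<close> at \<open>u = v = d / 2\<close>; the descent therefore runs on the rationally
  equivalent norm form of the Eisenstein integers.\<close>

lemma eisenstein_rational:
  fixes t d x y :: int
  assumes "d \<noteq> 0" and "t * d\<^sup>2 = x\<^sup>2 + 3 * y\<^sup>2"
  shows "\<exists>x y. t = x\<^sup>2 - x * y + y\<^sup>2"
proof -
  have "\<exists>x y. t = bqf 1 (-1) 1 x y"
  proof (rule aubry_davenport_cassels)
    show "x = 0 \<and> y = 0" if "bqf 1 (-1) 1 x y = 0" for x y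
    proof -
      have "x\<^sup>2 + y\<^sup>2 + (x - y)\<^sup>2 = 0"
        using that unfolding bqf_def by algebra
      moreover have "0 \<le> x\<^sup>2" "0 \<le> y\<^sup>2" "0 \<le> (x - y)\<^sup>2"
        by simp_all
      ultimately have "x\<^sup>2 = 0" "y\<^sup>2 = 0"
        by linarith+
      then show ?thesis by simp
    qed
    show "\<bar>bqf 1 (-1) 1 u v\<bar> < d\<^sup>2" if "d > 0" "\<bar>2 * u\<bar> \<le> d" "\<bar>2 * v\<bar> \<le> d" for d u v
    proof -
      \<comment> \<open>The first identity gives nonnegativity, the second the upper bound
        \<open>3 * d^2 / 4\<close>.\<close>
      have "2 * bqf 1 (-1) 1 u v = u\<^sup>2 + v\<^sup>2 + (u - v)\<^sup>2"
        "2 * bqf 1 (-1) 1 u v = 3 * u\<^sup>2 + 3 * v\<^sup>2 - (u + v)\<^sup>2"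
        unfolding bqf_def by algebra+
      moreover have "0 < d\<^sup>2" "0 \<le> u\<^sup>2" "0 \<le> v\<^sup>2" "0 \<le> (u - v)\<^sup>2" "0 \<le> (u + v)\<^sup>2"
        using that(1) by simp_all
      ultimately show ?thesis
        using half_square_bound[OF that(2)] half_square_bound[OF that(3)]
        unfolding abs_less_iff by linarith
    qed
    show "t * d\<^sup>2 = bqf 1 (-1) 1 (x + y) (2 * y)"
      using assms(2) unfolding bqf_def by algebra
  qed fact
  then show ?thesis by (simp add: bqf_def)
qed

text \<open>2 is inert in the Eisenstein integers: an even norm forces both coordinates to be even,
  and halving them divides \<open>2 * t\<close> by 4.\<close>

lemma C_rational:
  fixes t d x y :: int
  assumes "d \<noteq> 0" and "2 * t * d\<^sup>2 = x\<^sup>2 + 3 * y\<^sup>2"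
  shows "t \<in> C"
proof -
  obtain a b where ab: "2 * t = a\<^sup>2 - a * b + b\<^sup>2"
    using eisenstein_rational[OF assms] by blast
  then have "even (a\<^sup>2 - a * b + b\<^sup>2)"
    by (metis dvd_triv_left)
  then have "even a" "even b"
    by auto
  then obtain k l where "a = 2 * k" "b = 2 * l"
    by (auto elim!: evenE)
  then have "t = 2 * (k\<^sup>2 - k * l + l\<^sup>2)"
    using ab by (simp add: power2_eq_square)
  then show ?thesis by (auto simp: C_def)
qed

section \<open>The three inclusions\<close>

lemma zero_mem: "0 \<in> A" "0 \<in> B" "0 \<in> C"
  by (auto simp: A_def B_def C_def intro!: exI[of _ 0])

lemma norm_of_mem_A:
  assumes "t \<in> A"
  obtains p q where "2 * t = p\<^sup>2 - 3 * q\<^sup>2"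
proof -
  obtain x y where "t = 3 * x\<^sup>2 - y\<^sup>2"
    using assms by (auto simp: A_def)
  \<comment> \<open>These are the coordinates of
    \<open>(y + x\<close>\<surd>\<open>3)(1 +\<close>\<surd>\<open>3)\<close>, a product of elements
    of norms \<open>-t\<close> and \<open>-2\<close>.\<close>
  then have "2 * t = (y + 3 * x)\<^sup>2 - 3 * (x + y)\<^sup>2"
    by algebra
  then show thesis by (rule that)
qed

lemma norm_of_mem_B:
  assumes "t \<in> B"
  obtains p q where "2 * t = p\<^sup>2 - (-1) * q\<^sup>2"
proof -
  obtain x y where "t = x\<^sup>2 + y\<^sup>2"
    using assms by (auto simp: B_def)
  then have "2 * t = (x + y)\<^sup>2 - (-1) * (x - y)\<^sup>2"
    by algebra
  then show thesis by (rule that)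
qed

lemma norm_of_mem_C:
  assumes "t \<in> C"
  obtains p q where "2 * t = p\<^sup>2 - (-3) * q\<^sup>2"
proof -
  obtain x y where "t = 2 * (x\<^sup>2 - x * y + y\<^sup>2)"
    using assms by (auto simp: C_def)
  then have "2 * t = (2 * x - y)\<^sup>2 - (-3) * y\<^sup>2"
    by algebra
  then show thesis by (rule that)
qed

lemma A_Int_B_subset_C: "A \<inter> B \<subseteq> C"
proof
  fix t assume t: "t \<in> A \<inter> B"
  show "t \<in> C"
  proof (cases "t = 0")
    case False
    obtain p q r s where "2 * t = p\<^sup>2 - 3 * q\<^sup>2" "2 * t = r\<^sup>2 - (-1) * s\<^sup>2"
      using t norm_of_mem_A norm_of_mem_B by (metis IntE)
    then obtain d X Y where "d \<noteq> 0" "2 * t * d\<^sup>2 = X\<^sup>2 - 3 * (-1) * Y\<^sup>2"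
      using common_norm[of "2 * t"] False by (metis mult_eq_0_iff zero_neq_numeral)
    then show ?thesis
      using C_rational[of d t X Y] by simp
  qed (simp add: zero_mem)
qed

lemma B_Int_C_subset_A: "B \<inter> C \<subseteq> A"
proof
  fix t assume t: "t \<in> B \<inter> C"
  show "t \<in> A"
  proof (cases "t = 0")
    case False
    obtain p q r s where "2 * t = p\<^sup>2 - (-1) * q\<^sup>2" "2 * t = r\<^sup>2 - (-3) * s\<^sup>2"
      using t norm_of_mem_B norm_of_mem_C by (metis IntE)
    then obtain d X Y where d: "d \<noteq> 0" "2 * t * d\<^sup>2 = X\<^sup>2 - (-1) * (-3) * Y\<^sup>2"
      using common_norm[of "2 * t"] False by (metis mult_eq_0_iff zero_neq_numeral)
    \<comment> \<open>Multiplication of \<open>X + Y\<close>\<surd>\<open>3\<close> by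
      \<open>1 +\<close>\<surd>\<open>3\<close> undoes the doubling up to the square 4.\<close>
    then have "t * (2 * d)\<^sup>2 = 3 * (X + Y)\<^sup>2 - (X + 3 * Y)\<^sup>2"
      by algebra
    then show ?thesis
      using A_rational[of "2 * d"] d(1) by simp
  qed (simp add: zero_mem)
qed

lemma C_Int_A_subset_B: "C \<inter> A \<subseteq> B"
proof
  fix t assume t: "t \<in> C \<inter> A"
  show "t \<in> B"
  proof (cases "t = 0")
    case False
    obtain p q r s where "2 * t = p\<^sup>2 - (-3) * q\<^sup>2" "2 * t = r\<^sup>2 - 3 * s\<^sup>2"
      using t norm_of_mem_C norm_of_mem_A by (metis IntE)
    then obtain d X Y where d: "d \<noteq> 0" "2 * t * d\<^sup>2 = X\<^sup>2 - (-3) * 3 * Y\<^sup>2"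
      using common_norm[of "2 * t"] False by (metis mult_eq_0_iff zero_neq_numeral)
    \<comment> \<open>Since \<open>(-3) * 3 = -(3^2)\<close>, the right side is the norm of
      \<open>X + 3 * Y * i\<close>; multiplying by \<open>1 + i\<close> supplies another factor
      2.\<close>
    then have "t * (2 * d)\<^sup>2 = (X + 3 * Y)\<^sup>2 + (X - 3 * Y)\<^sup>2"
      by algebra
    then show ?thesis
      using B_rational[of "2 * d"] d(1) by simp
  qed (simp add: zero_mem)
qed

section \<open>Witnesses of strictness\<close>

lemma six_mem_C: "6 \<in> C"
proof -
  have "6 = 2 * (1\<^sup>2 - 1 * (-1) + (-1)\<^sup>2 :: int)"
    by simp
  then show ?thesis unfolding C_def by blast
qed

lemma six_not_mem_B: "6 \<notin> B"
proof
  assume "6 \<in> B"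
  then obtain x y :: int where xy: "6 = x\<^sup>2 + y\<^sup>2"
    unfolding B_def by blast
  have small: "z\<^sup>2 = 0 \<or> z\<^sup>2 = 1 \<or> z\<^sup>2 = 4" if "z\<^sup>2 \<le> 6" for z :: int
  proof -
    have "\<bar>z\<bar> < 3"
      by (rule power2_less_imp_less) (use that in simp_all)
    then have "z = -2 \<or> z = -1 \<or> z = 0 \<or> z = 1 \<or> z = 2"
      by presburger
    then show ?thesis by (elim disjE) simp_all
  qed
  have "x\<^sup>2 \<le> 6" "y\<^sup>2 \<le> 6"
    using xy zero_le_power2[of x] zero_le_power2[of y] by linarith+
  then show False
    using small[of x] small[of y] xy by linarith
qed

lemma minus_one_mem_A: "-1 \<in> A"
proof -
  have "-1 = 3 * 0\<^sup>2 - (1 :: int)\<^sup>2"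
    by simp
  then show ?thesis unfolding A_def by blast
qed

lemma minus_one_not_mem_B: "-1 \<notin> B"
proof
  assume "-1 \<in> B"
  then obtain x y :: int where "-1 = x\<^sup>2 + y\<^sup>2"
    by (auto simp: B_def)
  then show False
    using zero_le_power2[of x] zero_le_power2[of y] by linarith
qed

lemma one_mem_B: "1 \<in> B"
proof -
  have "1 = 1\<^sup>2 + (0 :: int)\<^sup>2"
    by simp
  then show ?thesis unfolding B_def by blast
qed

lemma one_not_mem_C: "1 \<notin> C"
proof
  assume "1 \<in> C"
  then obtain x y :: int where "1 = 2 * (x\<^sup>2 - x * y + y\<^sup>2)"
    unfolding C_def by blast
  then have "even (1 :: int)"
    by (metis dvd_triv_left)
  then show False by simp
qed

theorem theorem1p6:
  shows "A \<inter> B \<subset> C \<and> B \<inter> C \<subset> A \<and> C \<inter> A \<subset> B"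
  \<comment> \<open>Each of 6, -1 and 1 lies in the larger set but outside one of the two sets
    intersected.\<close>
  using A_Int_B_subset_C six_mem_C six_not_mem_B
    B_Int_C_subset_A minus_one_mem_A minus_one_not_mem_B
    C_Int_A_subset_B one_mem_B one_not_mem_C
  by blast

end
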